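(* Let $\alpha\ge2$. Then $$\frac{C(\alpha)}{1+2\alpha}\left(1-\frac{1}{\sqrt\alpha}\right)\le H_1(\alpha,\alpha)\le\left\|H_1(\alpha,\cdot)\right\|_{L_\infty[0,\infty)}\le\frac{C(\alpha)}{1+2\alpha}\left(1+\frac{2}{\sqrt\alpha}\right).$$
   Context: $C(\alpha)=\int_0^\infty\frac{t^\alpha}{\sinh t}\,dt$ for $\alpha>0$. $H_1(\alpha,x)=\int_0^\infty\frac{t^\alpha}{\sinh t}\frac{x}{x^2+t^2}\,dt$ for $\alpha>0$, $x>0$; for $\alpha>1$, $H_1(\alpha,0)=0$ (its limit as $x\to0^+$). *)

theory Defs
  imports "HOL-Analysis.Analysis" "HOL-Probability.Essential_Supremum"
begin

definition C_sinh :: "real \<Rightarrow> real" where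
  "C_sinh \<alpha> = (LBINT t:{0<..}. t powr \<alpha> / sinh t)"

text \<open>At \<open>x = 0\<close> the integrand vanishes identically, so \<open>H1 \<alpha> 0 = 0\<close>, which is the
  intended value (the limit as \<open>x\<close> tends to \<open>0\<close> from the right) for \<open>\<alpha> > 1\<close>.\<close>

definition H1 :: "real \<Rightarrow> real \<Rightarrow> real" where
  "H1 \<alpha> x = (LBINT t:{0<..}. t powr \<alpha> / sinh t * (x / (x\<^sup>2 + t\<^sup>2)))"

text \<open>The norm is extended-real valued, since \<^const>\<open>esssup\<close> is: it is \<open>\<infinity>\<close> for
  essentially unbounded (and for non-measurable) \<open>f\<close>.\<close>

definition Linf_norm :: "real set \<Rightarrow> (real \<Rightarrow> real) \<Rightarrow> ereal" where
  "Linf_norm S f = esssup (lebesgue_on S) (\<lambda>x. ereal \<bar>f x\<bar>)"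

end

theory Submission
  imports Defs
begin

text \<open>
  Since \<open>1 \<le> 1 / (1 - exp (- 2 * t)) \<le> 1 + 1 / (2 * t)\<close>, comparison with Euler's integral gives
  \<open>2 \<Gamma>(\<alpha> + 1) \<le> C(\<alpha>) \<le> 2 \<Gamma>(\<alpha> + 1) + \<Gamma>(\<alpha>)\<close>. For the upper bound, \<open>x / (x\<^sup>2 + t\<^sup>2) \<le> 1 / (2 * t)\<close>
  gives \<open>H\<^sub>1(\<alpha>, x) \<le> C(\<alpha> - 1) / 2\<close>. For the lower bound, \<open>1 / (\<alpha>\<^sup>2 + s)\<close> is convex in \<open>s = t\<^sup>2\<close>, so
  Jensen's inequality gives \<open>H\<^sub>1(\<alpha>, \<alpha>) \<ge> C(\<alpha>) \<alpha> / (\<alpha>\<^sup>2 + m)\<close> whenever \<open>C(\<alpha> + 2) \<le> m C(\<alpha>)\<close>.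
\<close>

section \<open>Gamma bounds for C(a)\<close>

lemma
  fixes s :: real
  assumes "s > 0"
  shows set_integrable_Gamma: "set_integrable lborel {0<..} (\<lambda>t. t powr (s - 1) / exp t)"
    and LBINT_Gamma: "(LBINT t:{0<..}. t powr (s - 1) / exp t) = Gamma s"
proof -
  \<comment> \<open>The indicators differ only at t = 0, where both sides vanish because
    \<open>0 powr _ = 0\<close>.\<close>
  have eq: "indicator {0<..} t *\<^sub>R (t powr (s - 1) / exp t) = indicator {0..} t * t powr (s - 1) / exp t"
    for t :: real
    by (auto simp: indicator_def)
  have "has_bochner_integral lborel (\<lambda>t. indicator {0..} t * t powr (s - 1) / exp t) (Gamma s)"
    using assms
    by (intro has_bochner_integral_nn_integral)
       (auto simp: Gamma_conv_nn_integral_real Gamma_real_pos less_imp_le)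
  then show "set_integrable lborel {0<..} (\<lambda>t. t powr (s - 1) / exp t)"
    and "(LBINT t:{0<..}. t powr (s - 1) / exp t) = Gamma s"
    unfolding set_integrable_def set_lebesgue_integral_def eq
    by (auto simp: has_bochner_integral_iff)
qed

lemma sinh_powr_lower:
  fixes t :: real
  assumes "t > 0"
  shows "2 * (t powr a / exp t) \<le> t powr a / sinh t"
proof -
  have "2 * sinh t \<le> exp t"
    by (simp add: sinh_field_def)
  then have "2 / exp t \<le> 1 / sinh t"
    using assms by (simp add: field_simps)
  from mult_left_mono[OF this, of "t powr a"] show ?thesis
    by (simp add: mult_ac)
qed

lemma sinh_powr_upper:
  fixes t :: real
  assumes "t > 0"
  shows "t powr a / sinh t \<le> 2 * (t powr a / exp t) + t powr (a - 1) / exp t"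
proof -
  \<comment> \<open>Cleared of denominators, the claim is (1 + 2 t) exp(-t) \<le> exp t, which is
    this inequality times exp(-t).\<close>
  have "1 + 2 * t \<le> exp (2 * t)"
    by (rule exp_ge_add_one_self)
  then have "(1 + 2 * t) * exp (- t) \<le> exp (2 * t) * exp (- t)"
    by (intro mult_right_mono) auto
  then have "(1 + 2 * t) * exp (- t) \<le> exp t"
    by (simp flip: exp_add)
  then have "t * exp t \<le> (2 * t + 1) * sinh t"
    by (simp add: sinh_field_def algebra_simps)
  then have "1 / sinh t \<le> (2 + 1 / t) / exp t"
    using assms by (simp add: field_simps)
  from mult_left_mono[OF this, of "t powr a"] show ?thesis
    using assms by (simp add: powr_diff field_simps)
qed

text \<open>Integrating the two pointwise bounds on 1 / sinh t gives both estimates. The upper one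
  is also the integrable majorant; its term \<open>t powr (a - 1) / exp t\<close> is integrable near
  0 because a > 0.\<close>

lemma
  assumes "a > 0"
  shows set_integrable_C_sinh: "set_integrable lborel {0<..} (\<lambda>t. t powr a / sinh t)"
    and C_sinh_lower: "2 * Gamma (a + 1) \<le> C_sinh a"
    and C_sinh_upper: "C_sinh a \<le> 2 * Gamma (a + 1) + Gamma a"
proof -
  have L: "set_integrable lborel {0<..} (\<lambda>t. 2 * (t powr a / exp t))"
    and Lv: "(LBINT t:{0<..}. 2 * (t powr a / exp t)) = 2 * Gamma (a + 1)"
    using set_integrable_Gamma[of "a + 1"] LBINT_Gamma[of "a + 1"] assms
    by (simp_all del: times_divide_eq_right)
  have U: "set_integrable lborel {0<..} (\<lambda>t. 2 * (t powr a / exp t) + t powr (a - 1) / exp t)"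
    and Uv: "(LBINT t:{0<..}. 2 * (t powr a / exp t) + t powr (a - 1) / exp t) = 2 * Gamma (a + 1) + Gamma a"
    using set_integral_add[OF L set_integrable_Gamma[OF assms]] Lv LBINT_Gamma[OF assms] by simp_all
  show int: "set_integrable lborel {0<..} (\<lambda>t. t powr a / sinh t)"
  proof (rule set_integrable_bound[OF U])
    show "set_borel_measurable lborel {0<..} (\<lambda>t. t powr a / sinh t)"
      unfolding set_borel_measurable_def sinh_field_def by measurable
    show "AE t in lborel. t \<in> {0<..} \<longrightarrow> norm (t powr a / sinh t)
        \<le> norm (2 * (t powr a / exp t) + t powr (a - 1) / exp t)"
      by (intro AE_I2 impI) (use sinh_powr_upper in \<open>auto simp: abs_of_nonneg intro: order_trans\<close>)
  qed
  show "2 * Gamma (a + 1) \<le> C_sinh a"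
    unfolding C_sinh_def Lv[symmetric]
    by (intro set_integral_mono L int sinh_powr_lower) auto
  show "C_sinh a \<le> 2 * Gamma (a + 1) + Gamma a"
    unfolding C_sinh_def Uv[symmetric]
    by (intro set_integral_mono U int sinh_powr_upper) auto
qed

lemma C_sinh_pos: "a > 0 \<Longrightarrow> C_sinh a > 0"
  using C_sinh_lower[of a] Gamma_real_pos[of "a + 1"] by linarith

section \<open>Ratios of C at shifted arguments\<close>

text \<open>The constant is the upper Gamma bound for C(a - 1) divided by the lower one for C(a),
  simplified by the functional equation of Gamma.\<close>

lemma C_sinh_pred_le:
  assumes "a > 1"
  shows "C_sinh (a - 1) \<le> (2 * a - 1) / (2 * a * (a - 1)) * C_sinh a"
proof -
  have G: "Gamma a = (a - 1) * Gamma (a - 1)" "Gamma (a + 1) = a * Gamma a"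
    using assms Gamma_plus1[of "a - 1"] Gamma_plus1[of a] nonpos_Ints_nonpos[of a]
      nonpos_Ints_nonpos[of "a - 1"] by force+
  have "C_sinh (a - 1) \<le> 2 * Gamma a + Gamma (a - 1)"
    using C_sinh_upper[of "a - 1"] assms by simp
  also have "\<dots> = (2 * a - 1) / (2 * a * (a - 1)) * (2 * Gamma (a + 1))"
    unfolding G using assms by (simp add: field_simps)
  also have "\<dots> \<le> (2 * a - 1) / (2 * a * (a - 1)) * C_sinh a"
    using assms by (intro mult_left_mono C_sinh_lower divide_nonneg_nonneg) auto
  finally show ?thesis .
qed

text \<open>The same quotient of Gamma bounds, now for C(a + 2) and C(a). It supplies the
  second-moment bound \<open>m\<close> for \<open>H1_ge\<close>.\<close>

lemma C_sinh_add2_le: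
  assumes "a > 0"
  shows "C_sinh (a + 2) \<le> (a + 1) * (a + 5/2) * C_sinh a"
proof -
  have G: "Gamma (a + 2) = (a + 1) * Gamma (a + 1)" "Gamma (a + 3) = (a + 2) * Gamma (a + 2)"
    using assms Gamma_plus1[of "a + 1"] Gamma_plus1[of "a + 2"] nonpos_Ints_nonpos[of "a + 1"]
      nonpos_Ints_nonpos[of "a + 2"] by (force simp: add.assoc)+
  have "C_sinh (a + 2) \<le> 2 * Gamma (a + 3) + Gamma (a + 2)"
    using C_sinh_upper[of "a + 2"] assms by (simp add: add.assoc)
  also have "\<dots> = (a + 1) * (a + 5/2) * (2 * Gamma (a + 1))"
    by (simp add: G algebra_simps)
  also have "\<dots> \<le> (a + 1) * (a + 5/2) * C_sinh a"
    using assms by (intro mult_left_mono C_sinh_lower) auto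
  finally show ?thesis .
qed

section \<open>Pointwise bounds for H1(a, x)\<close>

lemma H1_kernel_bound:
  fixes x t :: real
  assumes "x \<ge> 0" "t > 0"
  shows "x / (x\<^sup>2 + t\<^sup>2) \<le> 1 / (2 * t)"
proof -
  have pos: "x\<^sup>2 + t\<^sup>2 > 0" "2 * t > 0"
    using assms by (simp_all add: add_nonneg_pos)
  have "0 \<le> (x - t)\<^sup>2"
    by simp
  then have "x * (2 * t) \<le> 1 * (x\<^sup>2 + t\<^sup>2)"
    by (simp add: power2_eq_square algebra_simps)
  then show ?thesis
    using pos by (simp only: pos_divide_le_eq[OF pos(1)] times_divide_eq_left pos_le_divide_eq[OF pos(2)])
qed

lemma H1_integrand_le:
  fixes x t :: real
  assumes "x \<ge> 0" "t > 0"
  shows "t powr a / sinh t * (x / (x\<^sup>2 + t\<^sup>2)) \<le> 1 / 2 * (t powr (a - 1) / sinh t)"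
proof -
  have "t powr a / sinh t * (x / (x\<^sup>2 + t\<^sup>2)) \<le> t powr a / sinh t * (1 / (2 * t))"
    using assms by (intro mult_left_mono H1_kernel_bound) auto
  also have "\<dots> = 1 / 2 * (t powr (a - 1) / sinh t)"
    using assms by (simp add: powr_diff)
  finally show ?thesis .
qed

text \<open>The kernel bound gives a majorant independent of x, namely half the integrand of C(a -
  1), which is integrable since a > 1.\<close>

lemma set_integrable_H1:
  fixes a x :: real
  assumes "a > 1" "x \<ge> 0"
  shows "set_integrable lborel {0<..} (\<lambda>t. t powr a / sinh t * (x / (x\<^sup>2 + t\<^sup>2)))"
proof (rule set_integrable_bound)
  show "set_integrable lborel {0<..} (\<lambda>t. 1 / 2 * (t powr (a - 1) / sinh t))"
    using assms by (intro set_integrable_mult_right set_integrable_C_sinh) auto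
  show "set_borel_measurable lborel {0<..} (\<lambda>t. t powr a / sinh t * (x / (x\<^sup>2 + t\<^sup>2)))"
    unfolding set_borel_measurable_def sinh_field_def by measurable
  show "AE t in lborel. t \<in> {0<..} \<longrightarrow> norm (t powr a / sinh t * (x / (x\<^sup>2 + t\<^sup>2)))
      \<le> norm (1 / 2 * (t powr (a - 1) / sinh t))"
  proof (intro AE_I2 impI)
    fix t :: real assume "t \<in> {0<..}"
    with H1_integrand_le[of x t a] assms
    show "norm (t powr a / sinh t * (x / (x\<^sup>2 + t\<^sup>2))) \<le> norm (1 / 2 * (t powr (a - 1) / sinh t))"
      by (simp add: abs_mult)
  qed
qed

lemma H1_nonneg: "x \<ge> 0 \<Longrightarrow> H1 a x \<ge> 0"
  unfolding H1_def set_lebesgue_integral_def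
  by (intro Bochner_Integration.integral_nonneg) (auto simp: indicator_def)

lemma H1_le:
  assumes "a > 1" "x \<ge> 0"
  shows "H1 a x \<le> C_sinh (a - 1) / 2"
proof -
  have "H1 a x \<le> (LBINT t:{0<..}. 1 / 2 * (t powr (a - 1) / sinh t))"
    unfolding H1_def
    using assms
    by (intro set_integral_mono set_integrable_mult_right set_integrable_C_sinh set_integrable_H1
        H1_integrand_le) auto
  then have "H1 a x \<le> 1 / 2 * C_sinh (a - 1)"
    by (simp only: C_sinh_def set_integral_mult_right)
  then show ?thesis
    by simp
qed

text \<open>Jensen's inequality via a tangent line in s = t^2, touching at s = m. The line has
  nonpositive slope, so an upper bound m on the mean C(a + 2) / C(a) of t^2 suffices.\<close>

lemma H1_ge:
  assumes "a > 1" "x > 0" and m: "m \<ge> 0" "C_sinh (a + 2) \<le> m * C_sinh a"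
  shows "x / (x\<^sup>2 + m) * C_sinh a \<le> H1 a x"
proof -
  define D where "D = x\<^sup>2 + m"
  have D: "D > 0"
    using assms by (simp add: D_def add_pos_nonneg)
  \<comment> \<open>The tangent to x / (x^2 + s) at s = m is p - q s: its slope is -x / D^2, and its
    intercept is x (D + m) / D^2 with D + m = 2 D - x^2.\<close>
  define p where "p = x * (2 * D - x\<^sup>2) / D\<^sup>2"
  define q where "q = x / D\<^sup>2"
  have p0: "p \<ge> 0" and q0: "q \<ge> 0"
    using assms D by (auto simp: p_def q_def D_def)
  have tangent: "p * (t powr a / sinh t) - q * (t powr (a + 2) / sinh t)
      \<le> t powr a / sinh t * (x / (x\<^sup>2 + t\<^sup>2))" if "t > 0" for t
  proof -
    have pos: "x\<^sup>2 + t\<^sup>2 > 0"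
      using assms by (simp add: add_pos_nonneg)
    \<comment> \<open>With u = x^2 + t^2, the tangent of 1/u at u = D lies below the curve because
      (D - u)^2 \<ge> 0.\<close>
    have "(2 * D - (x\<^sup>2 + t\<^sup>2)) * (x\<^sup>2 + t\<^sup>2) \<le> D\<^sup>2"
      using zero_le_power2[of "D - (x\<^sup>2 + t\<^sup>2)"] by (simp add: power2_eq_square algebra_simps)
    then have "(2 * D - (x\<^sup>2 + t\<^sup>2)) / D\<^sup>2 \<le> 1 / (x\<^sup>2 + t\<^sup>2)"
      using D pos by (simp add: field_simps)
    then have "x * ((2 * D - (x\<^sup>2 + t\<^sup>2)) / D\<^sup>2) \<le> x * (1 / (x\<^sup>2 + t\<^sup>2))"
      using assms by (intro mult_left_mono) auto
    then have "p - q * t\<^sup>2 \<le> x / (x\<^sup>2 + t\<^sup>2)"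
      by (simp add: p_def q_def diff_divide_distrib add_divide_distrib algebra_simps)
    then have "t powr a / sinh t * (p - q * t\<^sup>2) \<le> t powr a / sinh t * (x / (x\<^sup>2 + t\<^sup>2))"
      using that by (intro mult_left_mono) auto
    moreover have "t powr (a + 2) = t powr a * t\<^sup>2"
      using that by (simp add: powr_add)
    ultimately show ?thesis
      by (simp add: algebra_simps)
  qed
  have ints: "set_integrable lborel {0<..} (\<lambda>t. p * (t powr a / sinh t))"
    "set_integrable lborel {0<..} (\<lambda>t. q * (t powr (a + 2) / sinh t))"
    using set_integrable_C_sinh[of a] set_integrable_C_sinh[of "a + 2"] assms
    by (auto simp del: times_divide_eq_right)
  \<comment> \<open>At the point of contact s = m the line has the value x / D.\<close>
  have "p - q * m = x * (2 * D - x\<^sup>2 - m) / D\<^sup>2"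
    by (simp add: p_def q_def diff_divide_distrib add_divide_distrib algebra_simps)
  also have "2 * D - x\<^sup>2 - m = D"
    by (simp add: D_def)
  also have "x * D / D\<^sup>2 = x / D"
    by (simp add: power2_eq_square)
  finally have "x / D * C_sinh a = p * C_sinh a - q * (m * C_sinh a)"
    by (simp add: algebra_simps)
  also have "\<dots> \<le> p * C_sinh a - q * C_sinh (a + 2)"
    using m q0 by (intro diff_left_mono mult_left_mono)
  also have "\<dots> = (LBINT t:{0<..}. p * (t powr a / sinh t) - q * (t powr (a + 2) / sinh t))"
    using ints by (simp add: set_integral_diff C_sinh_def del: times_divide_eq_right)
  also have "\<dots> \<le> H1 a x"
    unfolding H1_def
    using assms by (intro set_integral_mono set_integral_diff ints set_integrable_H1 tangent) auto
  finally show ?thesis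
    by (simp add: D_def)
qed

section \<open>Essential supremum of H1(a, .)\<close>

text \<open>This replaces continuity of \<open>H\<^sub>1(a, \<cdot>)\<close> from the right.\<close>

lemma H1_ge_scaled:
  assumes "a > 1" "0 < y" "y \<le> x"
  shows "y\<^sup>2 / x\<^sup>2 * H1 a y \<le> H1 a x"
proof -
  have "y\<^sup>2 / x\<^sup>2 * (t powr a / sinh t * (y / (y\<^sup>2 + t\<^sup>2))) \<le> t powr a / sinh t * (x / (x\<^sup>2 + t\<^sup>2))"
    if "t > 0" for t
  proof -
    have pos: "x\<^sup>2 + t\<^sup>2 > 0" "x\<^sup>2 * (y\<^sup>2 + t\<^sup>2) > 0"
      using assms by (simp_all add: add_pos_nonneg)
    have "y\<^sup>2 \<le> x\<^sup>2"
      using assms by (intro power_mono) auto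
    then have "y\<^sup>2 * t\<^sup>2 \<le> x\<^sup>2 * t\<^sup>2"
      by (intro mult_right_mono) auto
    \<comment> \<open>This says that u^2 / (u^2 + t^2) increases with u; the remaining factor of the
      kernel is handled by y \<le> x.\<close>
    then have "y\<^sup>2 * (x\<^sup>2 + t\<^sup>2) \<le> 1 * (x\<^sup>2 * (y\<^sup>2 + t\<^sup>2))"
      by (simp add: algebra_simps)
    then have "y\<^sup>2 / (x\<^sup>2 * (y\<^sup>2 + t\<^sup>2)) \<le> 1 / (x\<^sup>2 + t\<^sup>2)"
      by (simp only: pos_divide_le_eq[OF pos(2)] times_divide_eq_left pos_le_divide_eq[OF pos(1)])
    then have "y * (y\<^sup>2 / (x\<^sup>2 * (y\<^sup>2 + t\<^sup>2))) \<le> x * (1 / (x\<^sup>2 + t\<^sup>2))"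
      using assms by (intro mult_mono) auto
    from mult_left_mono[OF this, of "t powr a / sinh t"] that show ?thesis
      by (simp add: mult_ac)
  qed
  then have "(LBINT t:{0<..}. y\<^sup>2 / x\<^sup>2 * (t powr a / sinh t * (y / (y\<^sup>2 + t\<^sup>2)))) \<le> H1 a x"
    unfolding H1_def using assms
    by (intro set_integral_mono set_integrable_mult_right set_integrable_H1) auto
  then show ?thesis
    by (simp only: H1_def set_integral_mult_right)
qed

text \<open>The integrand is jointly measurable in x and t, so the parameter integral is measurable
  in x. Without measurability \<open>esssup\<close> would be \<infinity>.\<close>

lemma borel_measurable_H1 [measurable]: "H1 a \<in> borel_measurable borel"
proof -
  have "(\<lambda>x. \<integral>t. indicator {0<..} t *\<^sub>R (t powr a / sinh t * (x / (x\<^sup>2 + t\<^sup>2))) \<partial>lborel)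
      \<in> borel_measurable borel"
    unfolding sinh_field_def by measurable
  then show ?thesis
    by (simp add: H1_def[abs_def] set_lebesgue_integral_def)
qed

lemma Linf_norm_H1_le:
  assumes "\<And>x. x \<ge> 0 \<Longrightarrow> H1 a x \<le> c"
  shows "Linf_norm {0..} (H1 a) \<le> ereal c"
  unfolding Linf_norm_def
proof (rule esssup_I)
  have "(\<lambda>x. ereal \<bar>H1 a x\<bar>) \<in> borel_measurable borel"
    by measurable
  then have "(\<lambda>x. ereal \<bar>H1 a x\<bar>) \<in> borel_measurable lebesgue"
    by (simp add: measurable_completion)
  then show "(\<lambda>x. ereal \<bar>H1 a x\<bar>) \<in> borel_measurable (lebesgue_on {0..})"
    by (rule measurable_restrict_space1)
  show "AE x in lebesgue_on {0..}. ereal \<bar>H1 a x\<bar> \<le> ereal c"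
    using assms H1_nonneg[of _ a] by (intro AE_I2) auto
qed

text \<open>An essential supremum ignores single points, so the value at y is recovered as the limit
  of y^2 / x^2 * H1(a, y) for x \<rightarrow> y from the right, each of these being at most the
  norm.\<close>

lemma H1_le_Linf_norm:
  assumes "a > 1" "y > 0"
  shows "ereal (H1 a y) \<le> Linf_norm {0..} (H1 a)" (is "_ \<le> ?N")
proof (rule tendsto_upperbound)
  have "((\<lambda>x. y\<^sup>2 / x\<^sup>2 * H1 a y) \<longlongrightarrow> y\<^sup>2 / y\<^sup>2 * H1 a y) (at_right y)"
    using assms by (intro tendsto_intros) auto
  then show "((\<lambda>x. ereal (y\<^sup>2 / x\<^sup>2 * H1 a y)) \<longlongrightarrow> ereal (H1 a y)) (at_right y)"
    using assms by simp
  have "AE x in lebesgue_on {0..}. ereal \<bar>H1 a x\<bar> \<le> ?N"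
    unfolding Linf_norm_def by (rule esssup_AE)
  then have AE: "AE x in lebesgue. x \<in> {0..} \<longrightarrow> ereal \<bar>H1 a x\<bar> \<le> ?N"
    by (subst (asm) AE_restrict_space_iff) auto
  have "ereal (y\<^sup>2 / x\<^sup>2 * H1 a y) \<le> ?N" if "x > y" for x
  proof -
    \<comment> \<open>The interval (y, x) has positive measure, so some z in it avoids the
      exceptional null set; H1(a, z) then links the scaled value to the norm.\<close>
    have "\<not> (AE z in lebesgue. z \<notin> {y<..<x})"
    proof
      assume "AE z in lebesgue. z \<notin> {y<..<x}"
      then have "emeasure lebesgue {y<..<x} = 0"
        by (subst (asm) AE_iff_measurable[where N = "{y<..<x}"]) auto
      with that show False
        by simp
    qed
    moreover have "AE z in lebesgue. z \<notin> {y<..<x}"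
      if "\<And>z. y < z \<Longrightarrow> z < x \<Longrightarrow> \<not> ereal \<bar>H1 a z\<bar> \<le> ?N"
      using AE by (rule eventually_mono) (use that assms in force)
    ultimately obtain z where z: "y < z" "z < x" "ereal \<bar>H1 a z\<bar> \<le> ?N"
      by blast
    have "y\<^sup>2 / x\<^sup>2 * H1 a y \<le> y\<^sup>2 / z\<^sup>2 * H1 a y"
      using z assms by (intro mult_right_mono divide_left_mono power_mono H1_nonneg) auto
    also have "\<dots> \<le> H1 a z"
      using z assms by (intro H1_ge_scaled) auto
    also have "\<dots> \<le> \<bar>H1 a z\<bar>"
      by simp
    finally show ?thesis
      using z(3) by (meson ereal_less_eq(3) order_trans)
  qed
  then show "\<forall>\<^sub>F x in at_right y. ereal (y\<^sup>2 / x\<^sup>2 * H1 a y) \<le> ?N"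
    by (auto simp: eventually_at_filter)
qed auto

section \<open>Elementary inequalities for the constants\<close>

lemma lower_constant:
  fixes \<alpha> :: real
  assumes "\<alpha> \<ge> 2"
  shows "1 / (1 + 2 * \<alpha>) * (1 - 1 / sqrt \<alpha>) \<le> \<alpha> / (\<alpha>\<^sup>2 + (\<alpha> + 1) * (\<alpha> + 5/2))"
proof -
  define s where "s = sqrt \<alpha>"
  have s: "s > 0" "\<alpha> = s\<^sup>2"
    using assms by (auto simp: s_def)
  have pos: "s\<^sup>2 * s\<^sup>2 + (s\<^sup>2 + 1) * (s\<^sup>2 + 5/2) > 0" "1 + 2 * s\<^sup>2 > 0"
    by (simp_all add: add_nonneg_pos add_pos_nonneg)
  \<comment> \<open>A rational bound below sqrt 2: (5/4)^2 = 25/16 \<le> 2.\<close>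
  have s_ge: "s \<ge> 5/4"
    unfolding s_def using assms by (intro real_le_rsqrt) (simp add: power2_eq_square)
  \<comment> \<open>Clearing denominators in the claim leaves 0 \<le> 2 s^3 + 7/2 s + 5/2 / s - 5/2
    s^2 - 5/2. This sum of nonnegative terms expands to the same expression with the smaller
    constant -35/8.\<close>
  have "0 \<le> 2 * (s - 5/4) * s\<^sup>2 + 7/2 * (s - 5/4) + 5/2 / s"
    using s s_ge by auto
  then have "0 \<le> 2 * s ^ 3 + 7/2 * s + 5/2 / s - 5/2 * s\<^sup>2 - 35/8"
    by (simp add: algebra_simps power2_eq_square power3_eq_cube)
  then have "(1 - 1 / s) * (s\<^sup>2 * s\<^sup>2 + (s\<^sup>2 + 1) * (s\<^sup>2 + 5/2)) \<le> s\<^sup>2 * (1 + 2 * s\<^sup>2)"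
    using s by (simp add: field_simps power2_eq_square power3_eq_cube)
  then have "(1 - 1 / s) / (1 + 2 * s\<^sup>2) \<le> s\<^sup>2 / (s\<^sup>2 * s\<^sup>2 + (s\<^sup>2 + 1) * (s\<^sup>2 + 5/2))"
    by (simp only: pos_divide_le_eq[OF pos(2)] times_divide_eq_left pos_le_divide_eq[OF pos(1)])
  then show ?thesis
    using s(1) unfolding s_def[symmetric] s(2) by (simp add: power2_eq_square)
qed

text \<open>The left side is the factor from \<open>C_sinh_pred_le\<close>, halved as in
  \<open>H1_le\<close>. Cleared of denominators and divided by the square root s of \<alpha>, the
  claim becomes 4 \<alpha> - 1 \<le> 8 s (\<alpha> - 1).\<close>

lemma upper_constant:
  fixes \<alpha> :: real
  assumes "\<alpha> \<ge> 2"
  shows "(2 * \<alpha> - 1) / (2 * \<alpha> * (\<alpha> - 1)) / 2 \<le> 1 / (1 + 2 * \<alpha>) * (1 + 2 / sqrt \<alpha>)"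
proof -
  define s where "s = sqrt \<alpha>"
  have s: "s > 0" "\<alpha> = s\<^sup>2"
    using assms by (auto simp: s_def)
  have pos: "s * (1 + 2 * \<alpha>) > 0" "4 * \<alpha> * (\<alpha> - 1) > 0"
    using assms s(1) by simp_all
  have "s \<ge> 5/4"
    unfolding s_def using assms by (intro real_le_rsqrt) (simp add: power2_eq_square)
  then have "8 * (5/4) * (\<alpha> - 1) \<le> 8 * s * (\<alpha> - 1)"
    using assms by (intro mult_right_mono mult_left_mono) auto
  \<comment> \<open>Here 10 (\<alpha> - 1) \<ge> 4 \<alpha> - 1 amounts to \<alpha> \<ge>
    3/2.\<close>
  then have "4 * \<alpha> - 1 \<le> 8 * s * (\<alpha> - 1)"
    using assms by argo
  then have "s * (4 * \<alpha> - 1) \<le> s * (8 * s * (\<alpha> - 1))"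
    using s by (intro mult_left_mono) auto
  then have "(2 * \<alpha> - 1) * (s * (1 + 2 * \<alpha>)) \<le> (s + 2) * (4 * \<alpha> * (\<alpha> - 1))"
    by (simp add: s(2) algebra_simps power2_eq_square)
  then have "(2 * \<alpha> - 1) / (4 * \<alpha> * (\<alpha> - 1)) \<le> (s + 2) / (s * (1 + 2 * \<alpha>))"
    by (simp only: pos_divide_le_eq[OF pos(2)] times_divide_eq_left pos_le_divide_eq[OF pos(1)])
  also have "\<dots> = 1 / (1 + 2 * \<alpha>) * (1 + 2 / s)"
    using assms s(1) by (simp add: field_simps)
  finally show ?thesis
    by (simp add: s_def mult_ac)
qed

theorem theorem4p1:
  fixes \<alpha> :: real
  assumes "\<alpha> \<ge> 2"
  shows "C_sinh \<alpha> / (1 + 2 * \<alpha>) * (1 - 1 / sqrt \<alpha>) \<le> H1 \<alpha> \<alpha> \<and>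
    ereal (H1 \<alpha> \<alpha>) \<le> Linf_norm {0..} (H1 \<alpha>) \<and>
    Linf_norm {0..} (H1 \<alpha>) \<le> ereal (C_sinh \<alpha> / (1 + 2 * \<alpha>) * (1 + 2 / sqrt \<alpha>))"
proof (intro conjI)
  have C: "C_sinh \<alpha> \<ge> 0"
    using C_sinh_pos[of \<alpha>] assms by simp
  have "C_sinh \<alpha> / (1 + 2 * \<alpha>) * (1 - 1 / sqrt \<alpha>) \<le> \<alpha> / (\<alpha>\<^sup>2 + (\<alpha> + 1) * (\<alpha> + 5/2)) * C_sinh \<alpha>"
    using mult_right_mono[OF lower_constant[OF assms] C] by (simp add: mult_ac)
  \<comment> \<open>Jensen's bound at x = \<alpha> with m = (\<alpha> + 1) (\<alpha> + 5/2).\<close>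
  also have "\<dots> \<le> H1 \<alpha> \<alpha>"
    using assms by (intro H1_ge C_sinh_add2_le) auto
  finally show "C_sinh \<alpha> / (1 + 2 * \<alpha>) * (1 - 1 / sqrt \<alpha>) \<le> H1 \<alpha> \<alpha>" .
  show "ereal (H1 \<alpha> \<alpha>) \<le> Linf_norm {0..} (H1 \<alpha>)"
    using assms by (intro H1_le_Linf_norm) auto
  show "Linf_norm {0..} (H1 \<alpha>) \<le> ereal (C_sinh \<alpha> / (1 + 2 * \<alpha>) * (1 + 2 / sqrt \<alpha>))"
  proof (rule Linf_norm_H1_le)
    fix x :: real assume "x \<ge> 0"
    then have "H1 \<alpha> x \<le> C_sinh (\<alpha> - 1) / 2"
      using assms by (intro H1_le) auto
    also have "\<dots> \<le> (2 * \<alpha> - 1) / (2 * \<alpha> * (\<alpha> - 1)) / 2 * C_sinh \<alpha>"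
      using divide_right_mono[OF C_sinh_pred_le[of \<alpha>], of 2] assms
      by (simp only: times_divide_eq_left)
    also have "\<dots> \<le> 1 / (1 + 2 * \<alpha>) * (1 + 2 / sqrt \<alpha>) * C_sinh \<alpha>"
      by (intro mult_right_mono upper_constant assms C)
    finally show "H1 \<alpha> x \<le> C_sinh \<alpha> / (1 + 2 * \<alpha>) * (1 + 2 / sqrt \<alpha>)"
      by (simp add: mult_ac)
  qed
qed

end
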